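(* Let $\alpha\ge4$ and $K>0$. For any $\varepsilon\in(0,1)$ there exists a constant $C>0$ depending only on $\alpha$, $K$ and $\varepsilon$ such that, for all integers $n\ge2$, $p\ge1$ and $s\in[p]$, with $$t^{\mathrm{res}}=32\bigl\{\log(e^2p/s)+s^{-1}\log\log(8n)\bigr\},$$ there exists a test $\phi_{\mathcal{P},\mathrm{sparse}}^{\mathrm{MoM+res}}$ such that $$\mathcal{R}_{\mathcal{Q},\mathrm{res}}(\rho,\phi_{\mathcal{P},\mathrm{sparse}}^{\mathrm{MoM+res}})\le\varepsilon\qquad(\mathcal{Q}=\mathcal{P}_{\alpha,K}^{\otimes})$$ as long as $$\rho^2\ge C\,s\bigl\{\log(ep/s)+\log\log(8n)\bigr\}.$$
   Context: Notation: $[m]=\{1,\dots,m\}$; $\log$ is the natural logarithm; $\|v\|_0$ is the number of nonzero entries of $v$. Model: $X=\theta+E\in\mathbb{R}^{p\times n}$, with deterministic $\theta$ and random $E\sim P_e$; $\theta_t\in\mathbb{R}^p$ denotes the $t$-th column. $\mathbb{E}_{\theta,P_e}$ is expectation under the law of $X$. A test is a measurable map $\phi:\mathbb{R}^{p\times n}\to\{0,1\}$. Null space: $\Theta_0(p,n)=\{\theta:\exists\mu\in\mathbb{R}^p,\ \theta_t=\mu\ \forall t\in[n]\}$. For $t_0\in[n-1]$, $\Theta^{(t_0)}(p,n,s,\rho)$ is the set of $\theta$ for which there are $\mu_1,\mu_2\in\mathbb{R}^p$ with $\theta_t=\mu_1$ for $t\le t_0$, $\theta_t=\mu_2$ for $t>t_0$,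 $\|\mu_1-\mu_2\|_0\le s$ and $\frac{t_0(n-t_0)}{n}\|\mu_1-\mu_2\|_2^2\ge\rho^2$. Restricted alternative space: $\Theta_{\mathrm{res}}(p,n,s,\rho)=\bigcup_{t_0}\Theta^{(t_0)}(p,n,s,\rho)$, the union over integers $t_0$ with $t^{\mathrm{res}}+1\le t_0\le n-t^{\mathrm{res}}$ (a supremum over an empty set is $0$). Noise class: $\mathcal{P}_{\alpha,K}$ is the class of distributions of real random variables $W$ with $\mathbb{E}W=0$, $\mathbb{E}W^2=1$, $\mathbb{E}|W/K|^\alpha\le1$. $\mathcal{P}_{\alpha,K}^{\otimes}$ is the class of joint distributions of $E$ with mutually independent entries, each entry having a (possibly different) distribution in $\mathcal{P}_{\alpha,K}$. Worst-case testing error: $$\mathcal{R}_{\mathcal{Q},\mathrm{res}}(\rho,\phi)=\sup_{P_e\in\mathcal{Q}}\sup_{\theta\in\Theta_0(p,n)}\mathbb{E}_{\theta,P_e}(\phi)+\sup_{P_e\in\mathcal{Q}}\sup_{\theta\in\Theta_{\mathrm{res}}(p,n,s,\rho)}\mathbb{E}_{\theta,P_e}(1-\phi).$$ *)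

theory Defs
  imports "HOL-Probability.Probability"
begin

text \<open>
  A real \<open>p \<times> n\<close> matrix is a function on index pairs \<open>(i, t)\<close>, with \<open>1 \<le> i \<le> p\<close> the coordinate
  and \<open>1 \<le> t \<le> n\<close> the time, extended by \<^term>\<open>undefined\<close> outside the index set. The dimensions
  are ordinary naturals, so that constants can be chosen before them.
\<close>

type_synonym mat = "nat \<times> nat \<Rightarrow> real"

definition mat_index :: "nat \<Rightarrow> nat \<Rightarrow> (nat \<times> nat) set" where
  "mat_index p n = {1..p} \<times> {1..n}"

definition mat_space :: "nat \<Rightarrow> nat \<Rightarrow> mat measure" where
  "mat_space p n = (\<Pi>\<^sub>M k\<in>mat_index p n. borel)"

definition tests :: "nat \<Rightarrow> nat \<Rightarrow> (mat \<Rightarrow> real) set" where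
  "tests p n = mat_space p n \<rightarrow>\<^sub>M count_space {0, 1}"

definition noise_class :: "real \<Rightarrow> real \<Rightarrow> real measure set" where
  "noise_class \<alpha> K = {\<mu>. prob_space \<mu> \<and> sets \<mu> = sets borel
     \<and> integrable \<mu> (\<lambda>w. w) \<and> (\<integral>w. w \<partial>\<mu>) = 0
     \<and> integrable \<mu> (\<lambda>w. w\<^sup>2) \<and> (\<integral>w. w\<^sup>2 \<partial>\<mu>) = 1
     \<and> integrable \<mu> (\<lambda>w. \<bar>w / K\<bar> powr \<alpha>) \<and> (\<integral>w. \<bar>w / K\<bar> powr \<alpha> \<partial>\<mu>) \<le> 1}"

definition noise_class_indep :: "nat \<Rightarrow> nat \<Rightarrow> real \<Rightarrow> real \<Rightarrow> mat measure set" where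
  "noise_class_indep p n \<alpha> K = {P. prob_space P \<and> sets P = sets (mat_space p n)
     \<and> prob_space.indep_vars P (\<lambda>_. borel) (\<lambda>k E. E k) (mat_index p n)
     \<and> (\<forall>k\<in>mat_index p n. distr P borel (\<lambda>E. E k) \<in> noise_class \<alpha> K)}"

definition law_X :: "nat \<Rightarrow> nat \<Rightarrow> mat \<Rightarrow> mat measure \<Rightarrow> mat measure" where
  "law_X p n \<theta> P = distr P (mat_space p n) (\<lambda>E. \<lambda>k\<in>mat_index p n. \<theta> k + E k)"

definition l0_norm :: "nat \<Rightarrow> (nat \<Rightarrow> real) \<Rightarrow> nat" where
  "l0_norm p v = card {i \<in> {1..p}. v i \<noteq> 0}"

definition Theta_null :: "nat \<Rightarrow> nat \<Rightarrow> mat set" where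
  "Theta_null p n = {\<theta> \<in> space (mat_space p n).
     \<exists>\<mu>. \<forall>t\<in>{1..n}. \<forall>i\<in>{1..p}. \<theta> (i, t) = \<mu> i}"

definition Theta_at :: "nat \<Rightarrow> nat \<Rightarrow> nat \<Rightarrow> nat \<Rightarrow> real \<Rightarrow> mat set" where
  "Theta_at t0 p n s \<rho> = {\<theta> \<in> space (mat_space p n). \<exists>\<mu>\<^sub>1 \<mu>\<^sub>2.
     (\<forall>t\<in>{1..n}. \<forall>i\<in>{1..p}. \<theta> (i, t) = (if t \<le> t0 then \<mu>\<^sub>1 i else \<mu>\<^sub>2 i))
     \<and> l0_norm p (\<lambda>i. \<mu>\<^sub>1 i - \<mu>\<^sub>2 i) \<le> s
     \<and> real t0 * (real n - real t0) / real n * (L2_set (\<lambda>i. \<mu>\<^sub>1 i - \<mu>\<^sub>2 i) {1..p})\<^sup>2 \<ge> \<rho>\<^sup>2}"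

definition t_res :: "nat \<Rightarrow> nat \<Rightarrow> nat \<Rightarrow> real" where
  "t_res p n s = 32 * (ln (exp 2 * real p / real s) + ln (ln (8 * real n)) / real s)"

definition Theta_res :: "nat \<Rightarrow> nat \<Rightarrow> nat \<Rightarrow> real \<Rightarrow> mat set" where
  "Theta_res p n s \<rho> = (\<Union>t0 \<in> {t0 \<in> {1..n - 1}.
     t_res p n s + 1 \<le> real t0 \<and> real t0 \<le> real n - t_res p n s}. Theta_at t0 p n s \<rho>)"

text \<open>
  Suprema are taken in \<^typ>\<open>ennreal\<close>, where the supremum of the empty set is \<open>0\<close>.
\<close>

definition risk_res ::
    "mat measure set \<Rightarrow> nat \<Rightarrow> nat \<Rightarrow> nat \<Rightarrow> real \<Rightarrow> (mat \<Rightarrow> real) \<Rightarrow> ennreal" where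
  "risk_res Q p n s \<rho> \<phi> =
     (SUP P\<in>Q. SUP \<theta>\<in>Theta_null p n. ennreal (\<integral>X. \<phi> X \<partial>law_X p n \<theta> P))
   + (SUP P\<in>Q. SUP \<theta>\<in>Theta_res p n s \<rho>. ennreal (\<integral>X. 1 - \<phi> X \<partial>law_X p n \<theta> P))"

end

theory Submission
  imports Defs
begin

text \<open>
  Let \<open>D\<^sub>k = X\<^sub>k - X\<^sub>n\<^sub>+\<^sub>1\<^sub>-\<^sub>k\<close> for \<open>2k \<le> n\<close>. Under the null the mean cancels. If the change point \<open>t\<^sub>0\<close> satisfies
  \<open>t \<le> min t\<^sub>0 (n - t\<^sub>0)\<close>, then \<open>D\<^sub>1, \<dots>, D\<^sub>t\<close> all have mean \<open>\<mu>\<^sub>1 - \<mu>\<^sub>2\<close>. For each dyadic \<open>t = 2\<^sup>j\<^sup>+\<^sup>1\<close>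
  split the first \<open>2hm \<le> t\<close> differences into \<open>2h\<close> blocks of length \<open>m\<close>. In place of the median of
  the block sums \<open>S\<^sub>1, \<dots>, S\<^sub>2\<^sub>h\<close> of a coordinate, take the elementary symmetric polynomial of degree
  \<open>h\<close> in the squares \<open>S\<^sub>g\<^sup>2\<close>. By independence its null mean is \<open>(2h choose h) (2m)\<^sup>h \<le> (8m)\<^sup>h\<close>, so
  the sum over the \<open>p\<close> coordinates exceeds \<open>s (mB)\<^sup>h\<close> with probability at most \<open>(p/s) (8/B)\<^sup>h\<close>, by
  Markov's inequality and second moments alone. Like a median it is robust: a shift of all block
  sums by \<open>d\<close> forces \<open>(d/2)\<^sup>2\<^sup>h\<close> below the sum of the polynomials of data and noise, since at least half of
  the noise block sums, or at least half of the data block sums, are at least \<open>\<bar>d\<bar>/2\<close> in size. Hence on the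
  event that the noise alone is not rejected, a large enough change is rejected.

  With \<open>B = 8eR\<close> and \<open>h\<close> the minimum of \<open>2\<^sup>j\<close> and \<open>L = ln (ep/s) + ln (ln (8n))\<close> (rounded up), the factor \<open>p/s\<close> is
  absorbed by \<open>e\<^sup>h\<close> at all scales with \<open>2\<^sup>j \<ge> ln (p/s)\<close>; the scales with \<open>h = 2\<^sup>j\<close> then contribute a
  geometric series, and each of the \<open>O(ln n)\<close> other scales contributes \<open>O(1 / (R ln n))\<close>.
\<close>

section \<open>Second moments of sums of independent variables\<close>

lemma (in prob_space) indep_vars_sum_second_moment:
  fixes X :: "'i \<Rightarrow> 'a \<Rightarrow> real"
  assumes "finite J" and "indep_vars (\<lambda>_. borel) X J"
    and "\<And>k. k \<in> J \<Longrightarrow> integrable M (X k)" "\<And>k. k \<in> J \<Longrightarrow> expectation (X k) = 0"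
    and "\<And>k. k \<in> J \<Longrightarrow> integrable M (\<lambda>x. (X k x)\<^sup>2)"
  shows "integrable M (\<lambda>x. (\<Sum>k\<in>J. X k x)\<^sup>2)"
    and "expectation (\<lambda>x. (\<Sum>k\<in>J. X k x)\<^sup>2) = (\<Sum>k\<in>J. expectation (\<lambda>x. (X k x)\<^sup>2))"
proof -
  have "integrable M (\<lambda>x. (\<Sum>k\<in>J. X k x)\<^sup>2) \<and>
    expectation (\<lambda>x. (\<Sum>k\<in>J. X k x)\<^sup>2) = (\<Sum>k\<in>J. expectation (\<lambda>x. (X k x)\<^sup>2))"
    using assms
  proof (induction J rule: finite_induct)
    case empty
    then show ?case by simp
  next
    case (insert j J)
    let ?S = "\<lambda>x. \<Sum>k\<in>J. X k x"
    have indep: "indep_vars (\<lambda>_. borel) X J"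
      using insert.prems(1) by (rule indep_vars_subset) auto
    have IH: "integrable M (\<lambda>x. (?S x)\<^sup>2)"
      "expectation (\<lambda>x. (?S x)\<^sup>2) = (\<Sum>k\<in>J. expectation (\<lambda>x. (X k x)\<^sup>2))"
      using insert.IH[OF indep] insert.prems by auto
    have intS: "integrable M ?S"
      using insert.prems by auto
    \<comment> \<open>The new summand is independent of the partial sum and centred, so the cross
      term in the expanded square has mean zero.\<close>
    have Sj: "indep_var borel (X j) borel ?S"
      using insert by (intro indep_vars_sum) auto
    have cross: "expectation (\<lambda>x. X j x * ?S x) = 0" "integrable M (\<lambda>x. X j x * ?S x)"
      using indep_var_lebesgue_integral[OF Sj _ intS] indep_var_integrable[OF Sj _ intS] insert.prems
      by auto
    have eq: "(\<lambda>x. (\<Sum>k\<in>insert j J. X k x)\<^sup>2) = (\<lambda>x. (X j x)\<^sup>2 + 2 * (X j x * ?S x) + (?S x)\<^sup>2)"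
      using insert.hyps by (auto simp: power2_sum algebra_simps)
    have intj: "integrable M (\<lambda>x. (X j x)\<^sup>2)" using insert.prems by auto
    show ?case
      unfolding eq using intj cross IH insert.hyps by simp
  qed
  then show "integrable M (\<lambda>x. (\<Sum>k\<in>J. X k x)\<^sup>2)"
    and "expectation (\<lambda>x. (\<Sum>k\<in>J. X k x)\<^sup>2) = (\<Sum>k\<in>J. expectation (\<lambda>x. (X k x)\<^sup>2))"
    by auto
qed

section \<open>Blocks of mirrored differences and their symmetric polynomials\<close>

definition block :: "nat \<Rightarrow> nat \<Rightarrow> nat set" where
  "block m g = {g * m + 1..g * m + m}"

definition block_sum :: "nat \<Rightarrow> nat \<Rightarrow> nat \<Rightarrow> nat \<Rightarrow> mat \<Rightarrow> real" where
  "block_sum n m i g X = (\<Sum>k\<in>block m g. X (i, k) - X (i, n + 1 - k))"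

definition block_poly :: "nat \<Rightarrow> nat \<Rightarrow> nat \<Rightarrow> nat \<Rightarrow> mat \<Rightarrow> real" where
  "block_poly n m h i X = (\<Sum>H | H \<subseteq> {..<2 * h} \<and> card H = h. \<Prod>g\<in>H. (block_sum n m i g X)\<^sup>2)"

definition scale_stat :: "nat \<Rightarrow> nat \<Rightarrow> nat \<Rightarrow> nat \<Rightarrow> mat \<Rightarrow> real" where
  "scale_stat p n m h X = (\<Sum>i\<in>{1..p}. block_poly n m h i X)"

text \<open>The size condition keeps all blocks in the first half of the time axis. Hence a block
  index \<open>k\<close> is a valid time and is never the mirror image \<open>n + 1 - k'\<close> of
  another block index.\<close>

lemma block_bounds:
  assumes "2 * (2 * h * m) \<le> n" "g < 2 * h" "k \<in> block m g"
  shows "1 \<le> k" "k \<le> 2 * h * m" "2 * k \<le> n"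
proof -
  show "1 \<le> k" using assms by (auto simp: block_def)
  have "(g + 1) * m \<le> 2 * h * m" using assms by (intro mult_right_mono) auto
  then show "k \<le> 2 * h * m" using assms by (auto simp: block_def)
  then show "2 * k \<le> n" using assms by linarith
qed

lemma block_inj: "k \<in> block m g \<Longrightarrow> k \<in> block m g' \<Longrightarrow> g = g'"
proof -
  have "(k - 1) div m = a" if "k \<in> block m a" for a
    using that by (intro div_nat_eqI) (auto simp: block_def mult.commute)
  then show "k \<in> block m g \<Longrightarrow> k \<in> block m g' \<Longrightarrow> g = g'" by blast
qed

lemma finite_block [simp]: "finite (block m g)" and card_block [simp]: "card (block m g) = m"
  by (auto simp: block_def)

lemma block_sum_measurable [measurable]:
  assumes "2 * (2 * h * m) \<le> n" "g < 2 * h" "i \<in> {1..p}"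
  shows "block_sum n m i g \<in> borel_measurable (mat_space p n)"
  unfolding block_sum_def mat_space_def
proof (intro borel_measurable_sum borel_measurable_diff measurable_component_singleton)
  fix k assume "k \<in> block m g"
  then show "(i, k) \<in> mat_index p n" "(i, n + 1 - k) \<in> mat_index p n"
    using block_bounds[OF assms(1,2)] assms(3) by (force simp: mat_index_def)+
qed

lemma scale_stat_measurable:
  assumes "2 * (2 * h * m) \<le> n"
  shows "scale_stat p n m h \<in> borel_measurable (mat_space p n)"
  unfolding scale_stat_def block_poly_def
  using assms by (intro borel_measurable_sum borel_measurable_prod borel_measurable_power
      block_sum_measurable) auto

lemma scale_stat_nonneg: "0 \<le> scale_stat p n m h X"
  unfolding scale_stat_def block_poly_def by (intro sum_nonneg prod_nonneg) auto

section \<open>The statistic under pure noise\<close>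

lemma block_sum_moments:
  assumes P: "P \<in> noise_class_indep p n \<alpha> K" and n: "2 * (2 * h * m) \<le> n" and i: "i \<in> {1..p}"
  shows "prob_space.indep_vars P (\<lambda>_. borel) (\<lambda>g. block_sum n m i g) {..<2 * h}"
    and "\<And>g. g < 2 * h \<Longrightarrow> integrable P (\<lambda>E. (block_sum n m i g E)\<^sup>2)"
    and "\<And>g. g < 2 * h \<Longrightarrow> (\<integral>E. (block_sum n m i g E)\<^sup>2 \<partial>P) = 2 * real m"
proof -
  interpret prob_space P using P by (simp add: noise_class_indep_def)
  have indep: "indep_vars (\<lambda>_. borel) (\<lambda>k E. E k) (mat_index p n)"
    and nc: "\<And>k. k \<in> mat_index p n \<Longrightarrow> distr P borel (\<lambda>E. E k) \<in> noise_class \<alpha> K"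
    and sets: "sets P = sets (mat_space p n)"
    using P by (auto simp: noise_class_indep_def)
  \<comment> \<open>The sign is \<open>+1\<close> on the first half of the times and
    \<open>-1\<close> on their mirror images, so a block sum becomes the plain sum of the centred,
    unit-variance \<open>Y\<close> over the \<open>2 * m\<close> indices in
    \<open>I g\<close>.\<close>
  define c :: "nat \<times> nat \<Rightarrow> real" where "c k = (if 2 * snd k \<le> n then 1 else - 1)" for k
  define I where "I g = {i} \<times> (block m g \<union> (\<lambda>k. n + 1 - k) ` block m g)" for g
  define Y :: "nat \<times> nat \<Rightarrow> mat \<Rightarrow> real" where "Y k E = c k * E k" for k E
  have meas: "random_variable borel (\<lambda>E. E k)" if "k \<in> mat_index p n" for k
    using indep that by (auto simp: indep_vars_def)
  have m1: "integrable P (\<lambda>E. E k)" "expectation (\<lambda>E. E k) = 0"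
      "integrable P (\<lambda>E. (E k)\<^sup>2)" "expectation (\<lambda>E. (E k)\<^sup>2) = 1"
    if k: "k \<in> mat_index p n" for k
    using nc[OF k] unfolding noise_class_def
    by (simp_all add: integrable_distr_eq integral_distr meas[OF k])
  have I: "I g \<subseteq> mat_index p n" if "g < 2 * h" for g
    using block_bounds[OF n that] i by (force simp: I_def mat_index_def)
  \<comment> \<open>Subtraction on naturals truncates; the reflection is injective here because
    block indices do not exceed \<open>n\<close>.\<close>
  have inj: "inj_on (\<lambda>k. n + 1 - k) (block m g)" if "g < 2 * h" for g
    using block_bounds[OF n that] by (intro inj_onI) (smt (verit) diff_diff_cancel le_add2 le_trans mult_2 le_add1)
  have disj: "block m g \<inter> (\<lambda>k. n + 1 - k) ` block m g' = {}" if "g < 2 * h" "g' < 2 * h" for g g'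
    using block_bounds[OF n that(1)] block_bounds[OF n that(2)] by fastforce
  have sum_eq: "block_sum n m i g E = (\<Sum>k\<in>I g. Y k E)" if g: "g < 2 * h" for g E
  proof -
    have "(\<Sum>k\<in>I g. Y k E) = (\<Sum>k\<in>block m g \<union> (\<lambda>k. n + 1 - k) ` block m g. Y (i, k) E)"
      using sum.cartesian_product[of "\<lambda>a k. Y (a, k) E" "block m g \<union> (\<lambda>k. n + 1 - k) ` block m g" "{i}"]
      by (simp add: I_def case_prod_unfold)
    also have "\<dots> = (\<Sum>k\<in>block m g. Y (i, k) E) + (\<Sum>k\<in>block m g. Y (i, n + 1 - k) E)"
      using disj[OF g g] sum.reindex[OF inj[OF g], of "\<lambda>k. Y (i, k) E"]
      by (subst sum.union_disjoint) (auto simp: comp_def)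
    also have "\<dots> = (\<Sum>k\<in>block m g. E (i, k)) + (\<Sum>k\<in>block m g. - E (i, n + 1 - k))"
      using block_bounds[OF n g] by (intro arg_cong2[of _ _ _ _ "(+)"] sum.cong) (force simp: Y_def c_def)+
    finally show ?thesis by (simp add: block_sum_def sum_subtractf sum_negf)
  qed
  have indepY: "indep_vars (\<lambda>_. borel) Y (mat_index p n)"
    unfolding Y_def by (rule indep_vars_compose2[OF indep]) simp
  have fI: "finite (I g)" for g by (simp add: I_def)
  have Y: "integrable P (Y k)" "expectation (Y k) = 0"
      "integrable P (\<lambda>E. (Y k E)\<^sup>2)" "expectation (\<lambda>E. (Y k E)\<^sup>2) = 1"
    if "k \<in> mat_index p n" for k
    using m1[OF that] by (auto simp: Y_def[abs_def] power_mult_distrib c_def)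
  have cI: "card (I g) = 2 * m" if "g < 2 * h" for g
    using disj[OF that that] inj[OF that]
    by (auto simp: I_def card_cartesian_product card_Un_disjoint card_image)
  { fix g assume g: "g < 2 * h"
    note ms = indep_vars_sum_second_moment[OF fI indep_vars_subset[OF indepY I[OF g]]]
    show "integrable P (\<lambda>E. (block_sum n m i g E)\<^sup>2)"
      unfolding sum_eq[OF g] using Y I[OF g] by (intro ms(1)) auto
    have "expectation (\<lambda>E. (block_sum n m i g E)\<^sup>2) = (\<Sum>k\<in>I g. expectation (\<lambda>E. (Y k E)\<^sup>2))"
      unfolding sum_eq[OF g] using Y I[OF g] by (intro ms(2)) auto
    also have "\<dots> = (\<Sum>k\<in>I g. 1)"
      using Y(4) I[OF g] by (intro sum.cong) auto
    finally show "expectation (\<lambda>E. (block_sum n m i g E)\<^sup>2) = 2 * real m"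
      using cI[OF g] by simp }
  have "disjoint_family_on I {..<2 * h}"
    unfolding disjoint_family_on_def
  proof (intro ballI impI)
    fix g g' assume g: "g \<in> {..<2 * h}" "g' \<in> {..<2 * h}" "g \<noteq> g'"
    have g2: "g < 2 * h" "g' < 2 * h" using g by auto
    have "n + 1 - k \<noteq> n + 1 - k'" if k: "k \<in> block m g" "k' \<in> block m g'" for k k'
    proof -
      have "2 * k \<le> n" "2 * k' \<le> n"
        using block_bounds[OF n g2(1) k(1)] block_bounds[OF n g2(2) k(2)] by auto
      moreover have "k \<noteq> k'" using block_inj[of k m g g'] k g(3) by auto
      ultimately show ?thesis by linarith
    qed
    moreover have "block m g \<inter> block m g' = {}" using block_inj[of _ m g g'] g(3) by blast
    ultimately show "I g \<inter> I g' = {}"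
      using disj[OF g2] disj[OF g2(2,1)] unfolding I_def by blast
  qed
  \<comment> \<open>No noise entry occurs in two block sums, so these are measurable functions of
    independent subfamilies.\<close>
  then have "indep_vars (\<lambda>g. PiM (I g) (\<lambda>_. borel)) (\<lambda>g E. restrict (\<lambda>k. Y k E) (I g)) {..<2 * h}"
    using I by (intro indep_vars_restrict[OF indepY]) auto
  then have "indep_vars (\<lambda>_. borel) (\<lambda>g E. \<Sum>k\<in>I g. restrict (\<lambda>k. Y k E) (I g) k) {..<2 * h}"
    by (rule indep_vars_compose2) (intro borel_measurable_sum measurable_component_singleton, auto)
  then show "indep_vars (\<lambda>_. borel) (\<lambda>g. block_sum n m i g) {..<2 * h}"
    by (rule indep_vars_cong[THEN iffD1, rotated -1]) (auto simp: sum_eq fun_eq_iff)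
qed

text \<open>Each monomial of the polynomial multiplies squares of distinct, independent block sums,
  so its mean factors into second moments whatever the degree \<open>h\<close>. The number of
  monomials is at most \<open>4 ^ h\<close>.\<close>

lemma scale_stat_moment:
  assumes P: "P \<in> noise_class_indep p n \<alpha> K" and n: "2 * (2 * h * m) \<le> n"
  shows "integrable P (scale_stat p n m h)"
    and "(\<integral>E. scale_stat p n m h E \<partial>P) \<le> real p * (8 * real m) ^ h"
proof -
  interpret prob_space P using P by (simp add: noise_class_indep_def)
  let ?A = "{H. H \<subseteq> {..<2 * h} \<and> card H = h}"
  have ind: "indep_vars (\<lambda>_. borel) (\<lambda>g E. (block_sum n m i g E)\<^sup>2) H"
    if "i \<in> {1..p}" "H \<in> ?A" for i H
    using indep_vars_compose2[OF indep_vars_subset[OF block_sum_moments(1)[OF P n that(1)]],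
        where Y = "\<lambda>_ x. x\<^sup>2" and N = "\<lambda>_. borel"] that by auto
  have fin: "finite H" if "H \<in> ?A" for H using that finite_subset by blast
  have int: "integrable P (\<lambda>E. \<Prod>g\<in>H. (block_sum n m i g E)\<^sup>2)"
    if "i \<in> {1..p}" "H \<in> ?A" for i H
    by (rule indep_vars_integrable[OF fin[OF that(2)] ind[OF that]])
      (use block_sum_moments(2)[OF P n that(1)] that in auto)
  have val: "expectation (\<lambda>E. \<Prod>g\<in>H. (block_sum n m i g E)\<^sup>2) = (2 * real m) ^ h"
    if "i \<in> {1..p}" "H \<in> ?A" for i H
  proof -
    have "expectation (\<lambda>E. \<Prod>g\<in>H. (block_sum n m i g E)\<^sup>2)
        = (\<Prod>g\<in>H. expectation (\<lambda>E. (block_sum n m i g E)\<^sup>2))"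
      by (rule indep_vars_lebesgue_integral[OF fin[OF that(2)] ind[OF that]])
        (use block_sum_moments(2)[OF P n that(1)] that in auto)
    also have "\<dots> = (\<Prod>g\<in>H. 2 * real m)"
      using that by (intro prod.cong refl block_sum_moments(3)[OF P n]) auto
    finally show ?thesis using that by simp
  qed
  show "integrable P (scale_stat p n m h)"
    unfolding scale_stat_def[abs_def] block_poly_def using int
    by (intro Bochner_Integration.integrable_sum) auto
  have "expectation (block_poly n m h i) = (\<Sum>H\<in>?A. (2 * real m) ^ h)" if i: "i \<in> {1..p}" for i
  proof -
    have "expectation (block_poly n m h i) = (\<Sum>H\<in>?A. expectation (\<lambda>E. \<Prod>g\<in>H. (block_sum n m i g E)\<^sup>2))"
      unfolding block_poly_def[abs_def] by (rule Bochner_Integration.integral_sum) (rule int[OF i])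
    also have "\<dots> = (\<Sum>H\<in>?A. (2 * real m) ^ h)"
      by (intro sum.cong refl val[OF i])
    finally show ?thesis .
  qed
  moreover have "integrable P (block_poly n m h i)" if i: "i \<in> {1..p}" for i
    unfolding block_poly_def[abs_def] by (intro Bochner_Integration.integrable_sum int[OF i])
  ultimately have "expectation (scale_stat p n m h) = (\<Sum>i\<in>{1..p}. \<Sum>H\<in>?A. (2 * real m) ^ h)"
    unfolding scale_stat_def[abs_def] by (subst Bochner_Integration.integral_sum) (auto intro!: sum.cong)
  also have "\<dots> = real p * (real (2 * h choose h) * (2 * real m) ^ h)"
    using n_subsets[of "{..<2 * h}" h] by simp
  also have "\<dots> \<le> real p * (real (2 ^ (2 * h)) * (2 * real m) ^ h)"
    by (intro mult_left_mono mult_right_mono of_nat_mono binomial_le_pow2) auto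
  also have "\<dots> = real p * (8 * real m) ^ h"
    using power_mult_distrib[of 4 "2 * real m" h] by (auto simp: power_mult)
  finally show "expectation (scale_stat p n m h) \<le> real p * (8 * real m) ^ h" .
qed

text \<open>With \<open>s\<close> in place of \<open>p\<close> in the threshold, Markov's inequality
  costs a factor \<open>p / s\<close>. In return the threshold matches the at most \<open>s\<close>
  coordinates that can change.\<close>

lemma scale_stat_tail:
  assumes P: "P \<in> noise_class_indep p n \<alpha> K" and n: "2 * (2 * h * m) \<le> n"
    and "m > 0" "s > 0" "B > 0"
  shows "measure P {E \<in> space P. scale_stat p n m h E \<ge> real s * (real m * B) ^ h}
    \<le> real p / real s * (8 / B) ^ h"
proof -
  interpret prob_space P using P by (simp add: noise_class_indep_def)
  have pos: "real s * (real m * B) ^ h > 0" using assms by simp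
  have "measure P {E \<in> space P. scale_stat p n m h E \<ge> real s * (real m * B) ^ h}
    \<le> expectation (scale_stat p n m h) / (real s * (real m * B) ^ h)"
    using pos scale_stat_nonneg
    by (intro integral_Markov_inequality_measure[where A = "space P"] scale_stat_moment[OF P n]) auto
  also have "\<dots> \<le> real p * (8 * real m) ^ h / (real s * (real m * B) ^ h)"
    using pos by (intro divide_right_mono scale_stat_moment[OF P n]) auto
  also have "\<dots> = real p / real s * (8 / B) ^ h"
    using assms by (simp add: power_mult_distrib power_divide field_simps)
  finally show ?thesis .
qed

section \<open>Robustness of the statistic under a shift\<close>

lemma separation_le_block_poly:
  assumes dev: "\<And>g. g < 2 * h \<Longrightarrow> block_sum n m i g X = d + block_sum n m i g E"
  shows "((d / 2)\<^sup>2) ^ h \<le> block_poly n m h i X + block_poly n m h i E"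
proof -
  have lb: "((d / 2)\<^sup>2) ^ h \<le> block_poly n m h i Z"
    if G: "G \<subseteq> {..<2 * h}" "h \<le> card G" and ge: "\<And>g. g \<in> G \<Longrightarrow> \<bar>d / 2\<bar> \<le> \<bar>block_sum n m i g Z\<bar>" for Z G
  proof -
    \<comment> \<open>One monomial made of \<open>h\<close> large block sums suffices, as all other
      monomials are nonnegative.\<close>
    obtain H where H: "H \<subseteq> G" "card H = h" using obtain_subset_with_card_n[OF G(2)] by metis
    have "((d / 2)\<^sup>2) ^ h = (\<Prod>g\<in>H. (d / 2)\<^sup>2)" using H by simp
    also have "\<dots> \<le> (\<Prod>g\<in>H. (block_sum n m i g Z)\<^sup>2)"
    proof (intro prod_mono conjI)
      fix g assume "g \<in> H"
      then show "(d / 2)\<^sup>2 \<le> (block_sum n m i g Z)\<^sup>2"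
        using ge[of g] H by (subst abs_le_square_iff[symmetric]) auto
    qed simp
    also have "\<dots> \<le> block_poly n m h i Z"
      unfolding block_poly_def using H G by (intro member_le_sum prod_nonneg) auto
    finally show ?thesis .
  qed
  have nn: "0 \<le> block_poly n m h i Z" for Z
    unfolding block_poly_def by (intro sum_nonneg prod_nonneg) auto
  define G where "G = {g \<in> {..<2 * h}. \<bar>d / 2\<bar> \<le> \<bar>block_sum n m i g E\<bar>}"
  show ?thesis
  proof (cases "h \<le> card G")
    case True
    then have "((d / 2)\<^sup>2) ^ h \<le> block_poly n m h i E" by (intro lb[of G]) (auto simp: G_def)
    with nn[of X] show ?thesis by simp
  next
    case False
    \<comment> \<open>Fewer than \<open>h\<close> noise sums are large, so at least \<open>h\<close>
      are below \<open>\<bar>d / 2\<bar>\<close> in size; there the shift dominates and the data sum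
      is large.\<close>
    have "card ({..<2 * h} - G) = 2 * h - card G"
      by (subst card_Diff_subset) (auto simp: G_def)
    then have "h \<le> card ({..<2 * h} - G)" using False by linarith
    moreover have "\<bar>d / 2\<bar> \<le> \<bar>block_sum n m i g X\<bar>" if "g \<in> {..<2 * h} - G" for g
    proof -
      have "block_sum n m i g X = d + block_sum n m i g E" "\<bar>block_sum n m i g E\<bar> < \<bar>d / 2\<bar>"
        using that by (auto simp: G_def dev)
      then show ?thesis by linarith
    qed
    ultimately have "((d / 2)\<^sup>2) ^ h \<le> block_poly n m h i X"
      by (intro lb[of "{..<2 * h} - G"]) auto
    with nn[of E] show ?thesis by simp
  qed
qed

text \<open>Passes from a bound on \<open>h\<close>-th powers to one on the squares themselves, with
  a constant free of \<open>h\<close>. The statement is deterministic in \<open>X\<close> and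
  \<open>E\<close>.\<close>

lemma separation_le_scale_stat:
  assumes h: "h > 0" and a: "a > 0" and S: "S \<subseteq> {1..p}" "card S \<le> s"
    and dev: "\<And>i g. i \<in> S \<Longrightarrow> g < 2 * h \<Longrightarrow> block_sum n m i g X = d i + block_sum n m i g E"
    and XE: "scale_stat p n m h X \<le> real s * a ^ h" "scale_stat p n m h E \<le> real s * a ^ h"
  shows "(\<Sum>i\<in>S. (d i)\<^sup>2) \<le> 12 * a * real s"
proof -
  let ?V = "\<lambda>i. block_poly n m h i X + block_poly n m h i E"
  have nn: "0 \<le> block_poly n m h i Z" for Z i
    unfolding block_poly_def by (intro sum_nonneg prod_nonneg) auto
  \<comment> \<open>Linearises the power: either \<open>x <= a\<close>, or \<open>x / a\<close>
    exceeds 1 and is at most its \<open>h\<close>-th power.\<close>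
  have pow: "x \<le> a * (1 + (x / a) ^ h)" if "x \<ge> 0" for x
  proof (cases "x \<le> a")
    case True
    then show ?thesis using a that by (smt (verit) mult_left_mono[of 1 "1 + (x / a) ^ h" a] zero_le_power divide_nonneg_pos)
  next
    case False
    then have "x / a \<le> (x / a) ^ h" using a h by (intro self_le_power) auto
    then have "a * (x / a) \<le> a * (1 + (x / a) ^ h)" using a by (intro mult_left_mono) auto
    then show ?thesis using a by simp
  qed
  have "(\<Sum>i\<in>S. (d i / 2)\<^sup>2) \<le> (\<Sum>i\<in>S. a * (1 + ?V i / a ^ h))"
  proof (rule sum_mono)
    fix i assume i: "i \<in> S"
    have "(d i / 2)\<^sup>2 \<le> a * (1 + ((d i / 2)\<^sup>2 / a) ^ h)" by (rule pow) simp
    also have "\<dots> \<le> a * (1 + ?V i / a ^ h)"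
      unfolding power_divide[of "(d i / 2)\<^sup>2"]
      using a separation_le_block_poly[of h n m i X "d i" E] dev[OF i]
      by (intro mult_left_mono add_left_mono divide_right_mono) auto
    finally show "(d i / 2)\<^sup>2 \<le> a * (1 + ?V i / a ^ h)" .
  qed
  also have "\<dots> = a * (real (card S) + (\<Sum>i\<in>S. ?V i) / a ^ h)"
    by (simp add: sum_distrib_left[symmetric] sum.distrib sum_divide_distrib add_divide_distrib)
  also have "(\<Sum>i\<in>S. ?V i) \<le> (\<Sum>i\<in>{1..p}. ?V i)"
    using S nn by (intro sum_mono2) (auto intro: add_nonneg_nonneg)
  also have "(\<Sum>i\<in>{1..p}. ?V i) \<le> 2 * real s * a ^ h"
    using XE by (simp add: scale_stat_def sum.distrib)
  \<comment> \<open>The support contributes \<open>s\<close>, the statistics of data and noise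
    \<open>s\<close> each; undoing the halving of \<open>d\<close> turns 3 into 12.\<close>
  also have "a * (real (card S) + 2 * real s * a ^ h / a ^ h) \<le> a * (3 * real s)"
    using a S by (intro mult_left_mono) auto
  finally have "(\<Sum>i\<in>S. (d i / 2)\<^sup>2) \<le> a * (3 * real s)"
    using a by (simp add: divide_right_mono mult_left_mono)
  then show ?thesis by (simp add: power_divide sum_divide_distrib[symmetric])
qed


section \<open>Dyadic scales and the number of blocks\<close>

definition rate :: "nat \<Rightarrow> nat \<Rightarrow> nat \<Rightarrow> real" where
  "rate p n s = ln (exp 1 * real p / real s) + ln (ln (8 * real n))"

text \<open>More blocks sharpen the tail bound but raise the detectable jump size in proportion,
  hence the cap at the rate. The cap at \<open>2 ^ j\<close> keeps the block length
  positive.\<close>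

definition half_blocks :: "nat \<Rightarrow> nat \<Rightarrow> nat \<Rightarrow> nat \<Rightarrow> nat" where
  "half_blocks p n s j = min (2 ^ j) (nat \<lceil>rate p n s\<rceil>)"

definition block_len :: "nat \<Rightarrow> nat \<Rightarrow> nat \<Rightarrow> nat \<Rightarrow> nat" where
  "block_len p n s j = 2 ^ j div half_blocks p n s j"

text \<open>Scale \<open>j\<close> uses at most \<open>2 ^ (j + 1)\<close> differences, hence twice
  as many columns. The second condition ensures \<open>p / s <= exp h\<close> for
  \<open>h = half_blocks p n s j\<close>.\<close>

definition scales :: "nat \<Rightarrow> nat \<Rightarrow> nat \<Rightarrow> nat set" where
  "scales p n s = {j. 2 ^ (j + 2) \<le> n \<and> ln (real p / real s) \<le> 2 ^ j}"

definition rejects_at :: "real \<Rightarrow> nat \<Rightarrow> nat \<Rightarrow> nat \<Rightarrow> nat \<Rightarrow> mat \<Rightarrow> bool" where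
  "rejects_at B p n s j X \<longleftrightarrow> real s * (real (block_len p n s j) * B) ^ half_blocks p n s j
     < scale_stat p n (block_len p n s j) (half_blocks p n s j) X"

lemma rate_bounds:
  assumes "n \<ge> 2" "1 \<le> s" "s \<le> p"
  shows "1 + ln (ln (8 * real n)) \<le> rate p n s" "1 \<le> rate p n s"
    "ln (real p / real s) \<le> rate p n s" "1 \<le> ln (8 * real n)"
proof -
  have "exp 1 \<le> 8 * real n"
    using assms exp_le by linarith
  then show l: "1 \<le> ln (8 * real n)" using assms by (subst ln_ge_iff) auto
  then have ll: "0 \<le> ln (ln (8 * real n))" by simp
  have eq: "ln (exp 1 * real p / real s) = 1 + ln (real p / real s)"
    using assms by (simp add: ln_mult ln_div)
  have "0 \<le> ln (real p / real s)" using assms by simp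
  then show "1 + ln (ln (8 * real n)) \<le> rate p n s" "1 \<le> rate p n s"
      "ln (real p / real s) \<le> rate p n s"
    using ll eq by (auto simp: rate_def)
qed

text \<open>Each rounding costs at most a factor two: integer division because the quotient is
  positive, the ceiling because the rate is at least 1.\<close>

lemma block_params:
  assumes "n \<ge> 2" "1 \<le> s" "s \<le> p" "j \<in> scales p n s"
  shows "0 < half_blocks p n s j" "0 < block_len p n s j"
    "half_blocks p n s j * block_len p n s j \<le> 2 ^ j"
    "2 ^ j \<le> 2 * (half_blocks p n s j * block_len p n s j)"
    "2 * (2 * half_blocks p n s j * block_len p n s j) \<le> n"
    "real (half_blocks p n s j) \<le> 2 * rate p n s"
    "ln (real p / real s) \<le> real (half_blocks p n s j)"
proof -
  note rb = rate_bounds[OF assms(1-3)]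
  let ?h = "half_blocks p n s j" and ?m = "block_len p n s j"
  have ceil: "rate p n s \<le> real (nat \<lceil>rate p n s\<rceil>)" "real (nat \<lceil>rate p n s\<rceil>) \<le> 2 * rate p n s"
    using rb(2) by linarith+
  show h: "0 < ?h" using rb(2) by (simp add: half_blocks_def)
  have "?h \<le> 2 ^ j" by (simp add: half_blocks_def)
  then show m: "0 < ?m" using h by (simp add: block_len_def div_greater_zero_iff)
  show hm: "?h * ?m \<le> 2 ^ j" by (simp add: block_len_def)
  have "2 ^ j < ?h * (?m + 1)"
    unfolding block_len_def using h dividend_less_times_div[of ?h "2 ^ j"] by simp
  also have "\<dots> \<le> ?h * (?m + ?m)" using m by (intro mult_left_mono) auto
  finally show "2 ^ j \<le> 2 * (?h * ?m)" by (simp add: distrib_left)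
  have "4 * 2 ^ j \<le> n" using assms(4) by (simp add: scales_def power_add)
  then show "2 * (2 * ?h * ?m) \<le> n" using hm by linarith
  have "real ?h \<le> real (nat \<lceil>rate p n s\<rceil>)" by (simp add: half_blocks_def)
  with ceil show "real ?h \<le> 2 * rate p n s" by linarith
  have "ln (real p / real s) \<le> real (2 ^ j)" using assms(4) by (simp add: scales_def)
  then show "ln (real p / real s) \<le> real ?h"
    using ceil(1) rb(3) unfolding half_blocks_def of_nat_min by linarith
qed

lemma scales_card:
  assumes "n \<ge> 2"
  shows "finite (scales p n s)" "real (card (scales p n s)) \<le> 2 * ln (8 * real n)"
proof -
  have "scales p n s \<subseteq> {..<nat \<lfloor>2 * ln (8 * real n)\<rfloor>}"
  proof
    fix j assume "j \<in> scales p n s"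
    then have "real (2 ^ (j + 2)) \<le> real n" unfolding scales_def by (metis (lifting) mem_Collect_eq of_nat_mono)
    then have "ln (2 ^ (j + 2)) \<le> ln (8 * real n)" using assms by (subst ln_le_cancel_iff) auto
    moreover have "ln (2 ^ (j + 2)) = real (j + 2) * ln 2" by (rule ln_realpow)
    ultimately have "real (j + 2) * ln 2 \<le> ln (8 * real n)" by linarith
    moreover have "real (j + 2) * (1 / 2) \<le> real (j + 2) * ln 2"
      using ln2_ge_two_thirds by (intro mult_left_mono) auto
    ultimately have "real (j + 2) * (1 / 2) \<le> ln (8 * real n)" by (rule order.trans[rotated])
    then have "real j + 1 \<le> 2 * ln (8 * real n)" by simp
    then have "int j + 1 \<le> \<lfloor>2 * ln (8 * real n)\<rfloor>" by (simp add: le_floor_iff)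
    then show "j \<in> {..<nat \<lfloor>2 * ln (8 * real n)\<rfloor>}"
      by (simp only: lessThan_iff zless_nat_eq_int_zless add1_zle_eq)
  qed
  then show "finite (scales p n s)" by (rule finite_subset) simp
  have "card (scales p n s) \<le> nat \<lfloor>2 * ln (8 * real n)\<rfloor>"
    using card_mono[OF _ \<open>scales p n s \<subseteq> _\<close>] by simp
  moreover have "0 \<le> ln (8 * real n)" using assms by simp
  ultimately show "real (card (scales p n s)) \<le> 2 * ln (8 * real n)" by linarith
qed

text \<open>A power whose exponent is a minimum is at most the sum of the two powers. The first
  gives a geometric series over all scales; the second is constant in \<open>j\<close> and is
  multiplied by the number of scales.\<close>

lemma scales_tail_sum:
  fixes R :: real
  assumes "n \<ge> 2" "1 \<le> s" "s \<le> p" "R \<ge> 7"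
  shows "(\<Sum>j\<in>scales p n s. (1 / R) ^ half_blocks p n s j) \<le> 3 / (R - 1)"
proof -
  let ?q = "1 / R" and ?k = "nat \<lceil>rate p n s\<rceil>"
  note rb = rate_bounds[OF assms(1-3)]
  note fin = scales_card[OF assms(1), of p s]
  have q: "0 < ?q" "?q < 1" "?q \<le> exp (- 1)"
    using assms(4) exp_le by (auto simp: exp_minus field_simps)
  have "(\<Sum>j\<in>scales p n s. ?q ^ half_blocks p n s j) \<le> (\<Sum>j\<in>scales p n s. ?q * ?q ^ j + ?q ^ ?k)"
  proof (rule sum_mono)
    fix j
    \<comment> \<open>Uses \<open>j + 1 <= 2 ^ j\<close>.\<close>
    have "?q ^ 2 ^ j \<le> ?q ^ Suc j"
      using q by (intro power_decreasing) (auto simp: Suc_le_eq)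
    then show "?q ^ half_blocks p n s j \<le> ?q * ?q ^ j + ?q ^ ?k"
      using q by (auto simp: half_blocks_def min_def intro: add_increasing2 add_increasing)
  qed
  also have "\<dots> = ?q * (\<Sum>j\<in>scales p n s. ?q ^ j) + card (scales p n s) * ?q ^ ?k"
    by (simp add: sum.distrib sum_distrib_left)
  also have "\<dots> \<le> ?q * (1 / (1 - ?q)) + 2 * ?q"
  proof (intro add_mono mult_left_mono)
    have "(\<Sum>j\<in>scales p n s. ?q ^ j) \<le> (\<Sum>j. ?q ^ j)"
      using q fin by (intro sum_le_suminf summable_geometric) auto
    then show "(\<Sum>j\<in>scales p n s. ?q ^ j) \<le> 1 / (1 - ?q)"
      using q by (simp add: suminf_geometric)
    \<comment> \<open>One factor \<open>?q\<close> is set aside to supply the smallness in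
      \<open>R\<close>. The other \<open>k\<close> factors are at most \<open>exp (- 1)\<close>
      each, and \<open>k >= ln (ln (8 * n))\<close>, so together they cancel the logarithmic number
      of scales.\<close>
    obtain k where k: "?k = Suc k" using rb(2) by (cases ?k) auto
    have kr: "ln (ln (8 * real n)) \<le> real k" using k rb(1) by linarith
    have "?q ^ ?k = ?q * ?q ^ k" by (simp add: k)
    also have "\<dots> \<le> ?q * exp (- 1) ^ k"
      using q by (intro mult_left_mono power_mono) auto
    also have "\<dots> = ?q * exp (- real k)" by (simp flip: exp_of_nat_mult)
    also have "\<dots> \<le> ?q * exp (- ln (ln (8 * real n)))"
      using kr q by (intro mult_left_mono) auto
    also have "\<dots> = ?q * (1 / ln (8 * real n))" using rb(4) by (simp add: exp_minus divide_inverse)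
    finally have "card (scales p n s) * ?q ^ ?k \<le> 2 * ln (8 * real n) * (?q * (1 / ln (8 * real n)))"
      using fin q by (intro mult_mono) auto
    then show "card (scales p n s) * ?q ^ ?k \<le> 2 * ?q" using rb(4) by simp
  qed (use q in auto)
  \<comment> \<open>The left side is \<open>1 / (R - 1) + 2 / R\<close>.\<close>
  also have "\<dots> \<le> 3 / (R - 1)"
    using assms(4) by (simp add: field_simps)
  finally show ?thesis .
qed

section \<open>Rejection by the noise alone\<close>

lemma rejects_measurable:
  assumes "n \<ge> 2" "1 \<le> s" "s \<le> p"
  shows "{X \<in> space (mat_space p n). \<exists>j\<in>scales p n s. rejects_at B p n s j X} \<in> sets (mat_space p n)"
proof (rule sets.sets_Collect_finite_Ex[OF _ scales_card(1)[OF assms(1)]])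
  fix j assume "j \<in> scales p n s"
  then have [measurable]: "scale_stat p n (block_len p n s j) (half_blocks p n s j) \<in> borel_measurable (mat_space p n)"
    by (intro scale_stat_measurable block_params assms)
  show "{X \<in> space (mat_space p n). rejects_at B p n s j X} \<in> sets (mat_space p n)"
    unfolding rejects_at_def by measurable
qed

lemma noise_rejects_le:
  assumes P: "P \<in> noise_class_indep p n \<alpha> K" and psn: "n \<ge> 2" "1 \<le> s" "s \<le> p"
    and R: "R \<ge> 7" and B: "B = 8 * exp 1 * R"
  shows "measure P {E \<in> space P. \<exists>j\<in>scales p n s. rejects_at B p n s j E} \<le> 3 / (R - 1)"
proof -
  interpret prob_space P using P by (simp add: noise_class_indep_def)
  have sets: "sets P = sets (mat_space p n)" using P by (simp add: noise_class_indep_def)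
  have Bp: "B > 0" using R B by simp
  let ?A = "\<lambda>j. {E \<in> space P. scale_stat p n (block_len p n s j) (half_blocks p n s j) E
     \<ge> real s * (real (block_len p n s j) * B) ^ half_blocks p n s j}"
  have A: "?A j \<in> sets P" if "j \<in> scales p n s" for j
  proof -
    have [measurable]: "scale_stat p n (block_len p n s j) (half_blocks p n s j) \<in> borel_measurable P"
      using scale_stat_measurable[OF block_params(5)[OF psn that]] sets measurable_cong_sets by blast
    show ?thesis by measurable
  qed
  note fin = scales_card(1)[OF psn(1), of p s]
  have "measure P {E \<in> space P. \<exists>j\<in>scales p n s. rejects_at B p n s j E}
    \<le> measure P (\<Union>j\<in>scales p n s. ?A j)"
    using A fin by (intro finite_measure_mono) (auto simp: rejects_at_def)
  also have "\<dots> \<le> (\<Sum>j\<in>scales p n s. measure P (?A j))"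
    using A fin by (intro finite_measure_subadditive_finite) auto
  also have "\<dots> \<le> (\<Sum>j\<in>scales p n s. (1 / R) ^ half_blocks p n s j)"
  proof (rule sum_mono)
    fix j assume j: "j \<in> scales p n s"
    let ?h = "half_blocks p n s j"
    note bp = block_params[OF psn j]
    have "measure P (?A j) \<le> real p / real s * (8 / B) ^ ?h"
      using psn Bp bp by (intro scale_stat_tail[OF P]) auto
    \<comment> \<open>The factors of \<open>B\<close> are spent here: \<open>exp 1\<close> pays for
      \<open>p / s\<close>, 8 for the moment bound, and \<open>R\<close> remains.\<close>
    also have "\<dots> \<le> exp 1 ^ ?h * (8 / B) ^ ?h"
    proof (rule mult_right_mono)
      have "real p / real s = exp (ln (real p / real s))" using psn by simp
      also have "\<dots> \<le> exp (real ?h)" using bp(7) by simp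
      finally show "real p / real s \<le> exp 1 ^ ?h" by (simp flip: exp_of_nat_mult)
    qed (use Bp in simp)
    also have "\<dots> = (1 / R) ^ ?h" using R by (simp add: B flip: power_mult_distrib)
    finally show "measure P (?A j) \<le> (1 / R) ^ ?h" .
  qed
  also have "\<dots> \<le> 3 / (R - 1)" by (rule scales_tail_sum[OF psn R])
  finally show ?thesis .
qed

section \<open>Effect of the mean under null and alternative\<close>

lemma shift_null:
  assumes psn: "n \<ge> 2" "1 \<le> s" "s \<le> p" and \<theta>: "\<theta> \<in> Theta_null p n" and j: "j \<in> scales p n s"
  shows "rejects_at B p n s j (\<lambda>k\<in>mat_index p n. \<theta> k + E k) \<longleftrightarrow> rejects_at B p n s j E"
proof -
  let ?h = "half_blocks p n s j" and ?m = "block_len p n s j"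
  obtain \<mu> where \<mu>: "\<And>t i. t \<in> {1..n} \<Longrightarrow> i \<in> {1..p} \<Longrightarrow> \<theta> (i, t) = \<mu> i"
    using \<theta> by (auto simp: Theta_null_def)
  have "block_sum n ?m i g (\<lambda>k\<in>mat_index p n. \<theta> k + E k) = block_sum n ?m i g E"
    if "i \<in> {1..p}" "g < 2 * ?h" for i g
    unfolding block_sum_def
  proof (rule sum.cong)
    fix k assume "k \<in> block ?m g"
    then have "1 \<le> k" "2 * k \<le> n" using block_bounds[OF block_params(5)[OF psn j] that(2)] by auto
    then have "k \<in> {1..n}" "n + 1 - k \<in> {1..n}" by auto
    then show "(\<lambda>k\<in>mat_index p n. \<theta> k + E k) (i, k) - (\<lambda>k\<in>mat_index p n. \<theta> k + E k) (i, n + 1 - k)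
      = E (i, k) - E (i, n + 1 - k)"
      using that(1) \<mu> by (simp add: mat_index_def)
  qed simp
  then have "scale_stat p n ?m ?h (\<lambda>k\<in>mat_index p n. \<theta> k + E k) = scale_stat p n ?m ?h E"
    unfolding scale_stat_def block_poly_def by (intro sum.cong prod.cong refl) auto
  then show ?thesis by (simp add: rejects_at_def)
qed

text \<open>Holds for every noise matrix, at a scale depending on \<open>\<theta>\<close> only: if
  data and noise both stayed below the threshold, \<open>separation_le_scale_stat\<close> would make
  the jump too small for \<open>\<rho>\<close>.\<close>

lemma shift_alternative:
  assumes psn: "n \<ge> 2" "1 \<le> s" "s \<le> p" and B: "B > 0"
    and \<rho>: "\<rho>\<^sup>2 \<ge> 200 * B * real s * rate p n s" and \<theta>: "\<theta> \<in> Theta_res p n s \<rho>"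
  obtains j where "j \<in> scales p n s"
    "\<And>E. rejects_at B p n s j (\<lambda>k\<in>mat_index p n. \<theta> k + E k) \<or> rejects_at B p n s j E"
proof -
  obtain t0 \<mu>1 \<mu>2 where t0: "t0 \<in> {1..n - 1}" "t_res p n s + 1 \<le> real t0" "real t0 \<le> real n - t_res p n s"
    and \<mu>: "\<And>t i. t \<in> {1..n} \<Longrightarrow> i \<in> {1..p} \<Longrightarrow> \<theta> (i, t) = (if t \<le> t0 then \<mu>1 i else \<mu>2 i)"
    and l0: "l0_norm p (\<lambda>i. \<mu>1 i - \<mu>2 i) \<le> s"
    and sep: "real t0 * (real n - real t0) / real n * (L2_set (\<lambda>i. \<mu>1 i - \<mu>2 i) {1..p})\<^sup>2 \<ge> \<rho>\<^sup>2"
    using \<theta> by (auto simp: Theta_res_def Theta_at_def)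
  note rb = rate_bounds[OF psn]
  define t where "t = min t0 (n - t0)"
  define D where "D = (\<Sum>i\<in>{1..p}. (\<mu>1 i - \<mu>2 i)\<^sup>2)"
  have D0: "0 \<le> D" by (simp add: D_def sum_nonneg)
  have tres: "t_res p n s \<ge> 64 + 32 * ln (real p / real s)"
  proof -
    have "ln (exp 2 * real p / real s) = 2 + ln (real p / real s)"
      using psn by (simp add: ln_mult ln_div)
    moreover have "0 \<le> ln (ln (8 * real n)) / real s" using rb(4) by simp
    ultimately show ?thesis unfolding t_res_def by (simp add: algebra_simps)
  qed
  have lnps: "0 \<le> ln (real p / real s)" using psn by simp
  have t_lb: "t_res p n s \<le> real t" using t0 by (auto simp: t_def min_def of_nat_diff)
  then have t64: "64 + 32 * ln (real p / real s) \<le> real t" using tres by linarith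
  then have t2: "2 \<le> t" using lnps by linarith
  \<comment> \<open>The scale is one below the dyadic exponent of \<open>t\<close>, since it may use
    up to \<open>2 * 2 ^ j\<close> differences.\<close>
  obtain j' where j': "2 ^ j' \<le> t" "t < 2 ^ (j' + 1)"
    using ex_power_ivl1[of 2 t] t2 by auto
  then obtain j where "j' = Suc j" using t2 by (cases j') auto
  with j' have jt: "2 * 2 ^ j \<le> t" "t < 4 * 2 ^ j" by auto
  have "2 * t \<le> n" by (auto simp: t_def)
  then have "2 ^ (j + 2) \<le> n" using jt by (simp add: power_add)
  \<comment> \<open>The restriction on change points enters here:
    \<open>64 + 32 * ln (p / s) <= t < 4 * 2 ^ j\<close>.\<close>
  moreover have "ln (real p / real s) \<le> 2 ^ j"
  proof -
    have "real t < real (4 * 2 ^ j)" using jt(2) of_nat_less_iff by blast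
    then show ?thesis using t64 lnps by simp
  qed
  ultimately have j: "j \<in> scales p n s" by (simp add: scales_def)
  let ?h = "half_blocks p n s j" and ?m = "block_len p n s j"
  note bp = block_params[OF psn j]
  have "real t0 * (real n - real t0) / real n \<le> real t"
  proof -
    have "real t0 * (real n - real t0) \<le> real t * real n"
    proof (cases "t0 \<le> n - t0")
      case True
      then show ?thesis by (auto simp: t_def intro!: mult_left_mono)
    next
      case False
      then have "real t = real n - real t0" using t0 by (simp add: t_def min_def of_nat_diff)
      moreover have "real t0 \<le> real n" "0 \<le> real n - real t0" using t0 by auto
      ultimately show ?thesis by (simp add: mult.commute mult_right_mono)
    qed
    then show ?thesis using psn by (simp add: divide_le_eq)
  qed
  moreover have "(L2_set (\<lambda>i. \<mu>1 i - \<mu>2 i) {1..p})\<^sup>2 = D"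
    by (simp add: L2_set_def D_def sum_nonneg)
  ultimately have "\<rho>\<^sup>2 \<le> real t * D"
    using sep D0 by (smt (verit) mult_right_mono)
  moreover have "real t \<le> 8 * (real ?h * real ?m)"
  proof -
    have "t \<le> 8 * (?h * ?m)" using jt(2) bp(4) by linarith
    then show ?thesis by (metis of_nat_le_iff of_nat_mult of_nat_numeral)
  qed
  \<comment> \<open>Combining \<open>t <= 8 * h * m\<close> with \<open>h <= 2 * rate\<close> lets
    the rate cancel and leaves \<open>200 * B * s <= 16 * m * D\<close>.\<close>
  ultimately have "200 * B * real s * rate p n s \<le> 8 * (real ?h * real ?m) * D"
    using \<rho> D0 by (smt (verit) mult_right_mono)
  also have "\<dots> \<le> 8 * (2 * rate p n s * real ?m) * D"
    using bp(6) D0 by (intro mult_right_mono mult_left_mono) auto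
  finally have "rate p n s * (200 * B * real s) \<le> rate p n s * (16 * real ?m * D)"
    by (simp add: algebra_simps)
  then have mD: "200 * B * real s \<le> 16 * real ?m * D"
    using rb(2) by simp
  have "rejects_at B p n s j (\<lambda>k\<in>mat_index p n. \<theta> k + E k) \<or> rejects_at B p n s j E" for E
  proof (rule ccontr)
    assume nr: "\<not> ?thesis"
    let ?S = "{i \<in> {1..p}. \<mu>1 i - \<mu>2 i \<noteq> 0}"
    let ?d = "\<lambda>i. real ?m * (\<mu>1 i - \<mu>2 i)"
    have "block_sum n ?m i g (\<lambda>k\<in>mat_index p n. \<theta> k + E k) = ?d i + block_sum n ?m i g E"
      if i: "i \<in> {1..p}" and g: "g < 2 * ?h" for i g
    proof -
      have "block_sum n ?m i g (\<lambda>k\<in>mat_index p n. \<theta> k + E k)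
          = (\<Sum>k\<in>block ?m g. (\<mu>1 i - \<mu>2 i) + (E (i, k) - E (i, n + 1 - k)))"
        unfolding block_sum_def
      proof (rule sum.cong)
        fix k assume "k \<in> block ?m g"
        then have k: "1 \<le> k" "k \<le> 2 * ?h * ?m" using block_bounds[OF bp(5) g] by auto
        \<comment> \<open>Time \<open>k\<close> is thus at most \<open>t0\<close>, and its mirror
          image is at least \<open>t0 + 1\<close>, so each difference carries the full jump.\<close>
        have "k \<le> t" using k(2) bp(3) jt(1) by linarith
        then have "k \<in> {1..n}" "n + 1 - k \<in> {1..n}" "k \<le> t0" "\<not> n + 1 - k \<le> t0"
          using k(1) t0(1) by (auto simp: t_def)
        then show "(\<lambda>k\<in>mat_index p n. \<theta> k + E k) (i, k) - (\<lambda>k\<in>mat_index p n. \<theta> k + E k) (i, n + 1 - k)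
          = (\<mu>1 i - \<mu>2 i) + (E (i, k) - E (i, n + 1 - k))"
          using i \<mu> by (simp add: mat_index_def)
      qed simp
      also have "\<dots> = ?d i + block_sum n ?m i g E"
        unfolding block_sum_def by (subst sum.distrib) simp
      finally show ?thesis .
    qed
    then have "(\<Sum>i\<in>?S. (?d i)\<^sup>2) \<le> 12 * (real ?m * B) * real s"
      using nr bp B l0
      by (intro separation_le_scale_stat[where h = ?h and m = ?m and p = p and n = n and E = E
          and X = "\<lambda>k\<in>mat_index p n. \<theta> k + E k"])
        (auto simp: rejects_at_def l0_norm_def)
    moreover have "(\<Sum>i\<in>?S. (?d i)\<^sup>2) = (real ?m)\<^sup>2 * D"
    proof -
      have "(\<Sum>i\<in>?S. (?d i)\<^sup>2) = (\<Sum>i\<in>{1..p}. (?d i)\<^sup>2)"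
        by (intro sum.mono_neutral_left) auto
      then show ?thesis by (simp add: D_def power_mult_distrib sum_distrib_left)
    qed
    ultimately have "real ?m * (real ?m * D) \<le> real ?m * (12 * B * real s)"
      by (simp add: power2_eq_square algebra_simps)
    \<comment> \<open>Contradiction, since \<open>16 * 12 = 192 < 200\<close>.\<close>
    then have "real ?m * D \<le> 12 * B * real s" using bp(2) by simp
    moreover have "0 < B * real s" using B psn by simp
    ultimately show False using mD by linarith
  qed
  with j show ?thesis using that by blast
qed

section \<open>Both error probabilities bounded by the noise event\<close>

lemma law_integral_le:
  assumes P: "P \<in> noise_class_indep p n \<alpha> K" and f: "f \<in> borel_measurable (mat_space p n)"
    and f01: "\<And>X. 0 \<le> f X \<and> f X \<le> 1"
    and A: "A \<in> sets P"
    and le: "\<And>E. E \<in> space P \<Longrightarrow> E \<notin> A \<Longrightarrow> f (\<lambda>k\<in>mat_index p n. \<theta> k + E k) = 0"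
  shows "(\<integral>X. f X \<partial>law_X p n \<theta> P) \<le> measure P A"
proof -
  interpret prob_space P using P by (simp add: noise_class_indep_def)
  have sets: "sets P = sets (mat_space p n)" using P by (simp add: noise_class_indep_def)
  have [measurable]: "(\<lambda>E. E k) \<in> borel_measurable P" if "k \<in> mat_index p n" for k
    using that sets measurable_component_singleton[of k "mat_index p n" "\<lambda>_. borel"]
      measurable_cong_sets[OF sets refl] unfolding mat_space_def by blast
  have sh: "(\<lambda>E. \<lambda>k\<in>mat_index p n. \<theta> k + E k) \<in> P \<rightarrow>\<^sub>M mat_space p n"
    unfolding mat_space_def by (intro measurable_restrict) auto
  have "(\<integral>X. f X \<partial>law_X p n \<theta> P) = expectation (\<lambda>E. f (\<lambda>k\<in>mat_index p n. \<theta> k + E k))"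
    unfolding law_X_def using sh f by (rule integral_distr)
  also have "\<dots> \<le> expectation (indicator A)"
  proof (rule integral_mono)
    show "integrable P (\<lambda>E. f (\<lambda>k\<in>mat_index p n. \<theta> k + E k))"
      using f01 measurable_compose[OF sh f]
      by (intro integrable_const_bound[where B = 1]) auto
    show "integrable P (indicator A :: mat \<Rightarrow> real)"
      using A by (simp add: integrable_indicator_iff emeasure_eq_measure)
    fix E assume "E \<in> space P"
    then show "f (\<lambda>k\<in>mat_index p n. \<theta> k + E k) \<le> indicator A E"
      using le[of E] f01 by (auto simp: indicator_def)
  qed
  also have "\<dots> = measure P A" using A by simp
  finally show ?thesis .
qed

theorem theorem14:
  fixes \<alpha> K \<epsilon> :: real
  assumes "\<alpha> \<ge> 4" and "K > 0" and "0 < \<epsilon>" and "\<epsilon> < 1"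
  shows "\<exists>C>0. \<forall>n\<ge>2. \<forall>p\<ge>1. \<forall>s\<in>{1..p}. \<exists>\<phi>\<in>tests p n. \<forall>\<rho>::real.
           \<rho>\<^sup>2 \<ge> C * real s * (ln (exp 1 * real p / real s) + ln (ln (8 * real n)))
           \<longrightarrow> risk_res (noise_class_indep p n \<alpha> K) p n s \<rho> \<phi> \<le> ennreal \<epsilon>"
proof -
  \<comment> \<open>Gives each of the two errors the budget \<open>\<epsilon> / 2\<close>.\<close>
  define R where "R = 1 + 6 / \<epsilon>"
  define B where "B = 8 * exp 1 * R"
  have R: "R \<ge> 7" "3 / (R - 1) = \<epsilon> / 2"
    using assms by (auto simp: R_def field_simps)
  then have B: "B > 0" by (simp add: B_def)
  show ?thesis
  proof (intro exI[of _ "200 * B"] conjI allI impI ballI)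
    show "200 * B > 0" using B by simp
    fix n p s :: nat assume np: "n \<ge> 2" "p \<ge> 1" and "s \<in> {1..p}"
    then have psn: "n \<ge> 2" "1 \<le> s" "s \<le> p" by auto
    define rej where "rej X \<longleftrightarrow> (\<exists>j\<in>scales p n s. rejects_at B p n s j X)" for X
    define \<phi> :: "mat \<Rightarrow> real" where "\<phi> X = (if rej X then 1 else 0)" for X
    have rej_set: "{X \<in> space (mat_space p n). rej X} \<in> sets (mat_space p n)"
      unfolding rej_def by (rule rejects_measurable[OF psn])
    then have rej_pred: "Measurable.pred (mat_space p n) rej" by (simp add: pred_def)
    then have tests: "\<phi> \<in> tests p n"
      unfolding tests_def \<phi>_def by measurable
    have meas: "\<phi> \<in> borel_measurable (mat_space p n)"
      using rej_pred unfolding \<phi>_def by measurable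
    show "\<exists>\<phi>\<in>tests p n. \<forall>\<rho>. 200 * B * real s * (ln (exp 1 * real p / real s) + ln (ln (8 * real n))) \<le> \<rho>\<^sup>2
        \<longrightarrow> risk_res (noise_class_indep p n \<alpha> K) p n s \<rho> \<phi> \<le> ennreal \<epsilon>"
    proof (intro bexI[of _ \<phi>] allI impI tests)
      fix \<rho> :: real
      assume \<rho>: "200 * B * real s * (ln (exp 1 * real p / real s) + ln (ln (8 * real n))) \<le> \<rho>\<^sup>2"
      let ?A = "\<lambda>P. {E \<in> space P. rej E}"
      have A: "?A P \<in> sets P" "measure P (?A P) \<le> \<epsilon> / 2"
        if "P \<in> noise_class_indep p n \<alpha> K" for P
      proof -
        have "sets P = sets (mat_space p n)" using that by (simp add: noise_class_indep_def)
        then show "?A P \<in> sets P" using rej_set sets_eq_imp_space_eq by metis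
        show "measure P (?A P) \<le> \<epsilon> / 2"
          using noise_rejects_le[OF that psn R(1) B_def] R(2) by (simp add: rej_def)
      qed
      have "(\<integral>X. \<phi> X \<partial>law_X p n \<theta> P) \<le> \<epsilon> / 2"
        if P: "P \<in> noise_class_indep p n \<alpha> K" and \<theta>: "\<theta> \<in> Theta_null p n" for P \<theta>
        using law_integral_le[OF P meas _ A(1)[OF P], of \<theta>] A(2)[OF P] shift_null[OF psn \<theta>, of _ B]
        by (force simp: \<phi>_def rej_def)
      moreover have "(\<integral>X. 1 - \<phi> X \<partial>law_X p n \<theta> P) \<le> \<epsilon> / 2"
        if P: "P \<in> noise_class_indep p n \<alpha> K" and \<theta>: "\<theta> \<in> Theta_res p n s \<rho>" for P \<theta>
      proof -
        obtain j where "j \<in> scales p n s"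
          "\<And>E. rejects_at B p n s j (\<lambda>k\<in>mat_index p n. \<theta> k + E k) \<or> rejects_at B p n s j E"
          using shift_alternative[OF psn B _ \<theta>] \<rho> unfolding rate_def by blast
        then have "rej (\<lambda>k\<in>mat_index p n. \<theta> k + E k) \<or> rej E" for E
          unfolding rej_def by blast
        \<comment> \<open>Accepting the data forces the noise alone to be rejected, so the event
          that bounds the first error also bounds the second.\<close>
        then have "(\<integral>X. 1 - \<phi> X \<partial>law_X p n \<theta> P) \<le> measure P (?A P)"
          by (intro law_integral_le[OF P borel_measurable_diff[OF borel_measurable_const meas] _ A(1)[OF P]])
            (auto simp: \<phi>_def)
        with A(2)[OF P] show ?thesis by linarith
      qed
      ultimately have "risk_res (noise_class_indep p n \<alpha> K) p n s \<rho> \<phi>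
          \<le> ennreal (\<epsilon> / 2) + ennreal (\<epsilon> / 2)"
        unfolding risk_res_def by (intro add_mono SUP_least ennreal_leI) auto
      also have "\<dots> = ennreal \<epsilon>"
        using assms by (subst ennreal_plus[symmetric]) auto
      finally show "risk_res (noise_class_indep p n \<alpha> K) p n s \<rho> \<phi> \<le> ennreal \<epsilon>" .
    qed
  qed
qed

end
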